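(* Let $K\in L^1(\Omega)$ (real- or complex-valued), let $f\in\mathcal{C}(\Omega)$, and put $F=Kf$. Let $0<n'\le n$ be integers, and let the $m$-point quadrature rule with points $x_j\in\Omega$ and weights $w_j>0$, $j=1,\dots,m$, have exactness degree $n+n'$ and satisfy the Marcinkiewicz--Zygmund property with constant $\eta\in[0,1)$. Let $\mathcal{S}_nF$ be the efficient hyperinterpolant of degree $n$ of $F=Kf$. Then $$\|\mathcal{S}_nF\|_2\leq \frac{V^{1/2} A_n}{\sqrt{1-\eta}}\,\|f\|_{\infty},\qquad A_n=\sqrt{\sum_{\ell=1}^{d_n}\sum_{\ell'=1}^{d_n}|\alpha_{\ell'\ell}|^2},\qquad \alpha_{\ell'\ell}=\int_{\Omega}Kp_{\ell'}p_{\ell}\,\mathrm{d}\omega,$$ and $$\|\mathcal{S}_nF-F\|_1\leq \left(\frac{VA_n}{\sqrt{1-\eta}}+\|K\|_1\right)E_{n'}(f)+\left(V^{1/2}\sum_{\ell=1}^{d_n}\|p_{\ell}\|_{\infty}+1\right)E_n^{(1)}(K\chi^* ),$$ where $E_{n'}(f)=\inf_{\chi\in\mathbb{P}_{n'}}\|f-\chi\|_\infty$, $E_n^{(1)}(g)=\inf_{\chi\in\mathbb{P}_n}\|g-\chi\|_1$, and $\chi^*\in\mathbb{P}_{n'}$ is the best uniform approximation of $f$ in $\mathbb{P}_{n'}$, i.e. $\|f-\chi^*\|_\infty=E_{n'}(f)$.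
   Context: $\Omega\subset\mathbb{R}^s$ is a bounded region, either the closure of a connected open domain or a smooth closed lower-dimensional manifold, with a given measure $\mathrm{d}\omega$ of finite total mass $V=\int_\Omega \mathrm{d}\omega<\infty$. $L^p(\Omega)$ ($1\le p<\infty$) is taken with respect to $\mathrm{d}\omega$ with norm $\|g\|_p=(\int_\Omega|g|^p\,\mathrm{d}\omega)^{1/p}$, and $\|g\|_\infty=\sup_{x\in\Omega}|g(x)|$. $\mathcal{C}(\Omega)$ is the space of continuous functions with norm $\|\cdot\|_\infty$. $\langle v,z\rangle=\int_\Omega v\bar z\,\mathrm{d}\omega$. Scalars are real if all given functions are real-valued, and complex otherwise. $\mathbb{P}_n$ is the linear space (over these scalars) of restrictions to $\Omega$ of polynomials of degree at most $n$, $d_n=\dim\mathbb{P}_n$, and $p_1,\dots,p_{d_n}$ is an orthonormal basis of $\mathbb{P}_n$ for $\langle\cdot,\cdot\rangle$ consisting of real-valued polynomials. Quadrature rule: points $x_j\in\Omega$, weights $w_j>0$ ($j=1,\dots,m$); write $\langle v,z\rangle_m=\sum_{j=1}^m w_jv(x_j)\overline{z(x_j)}$. Exactness degree $N$ means $\sum_{j=1}^m w_jg(x_j)=\int_\Omega g\,\mathrm{d}\omega$ for all $g\in\mathbb{P}_N$. The Marcinkiewicz--Zygmund property with constant $\eta\in[0,1)$ means $\left|\sum_{j=1}^m w_j\chi(x_j)^2-\int_\Omega\chi^2\,\mathrm{d}\omega\right|\le\eta\int_\Omega\chi^2\,\mathrm{d}\omega$ for all real-valued $\chi\in\mathbb{P}_n$,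 with $\eta=0$ if $n'=n$. Hyperinterpolant of a continuous $f$: $\mathcal{L}_nf=\sum_{\ell=1}^{d_n}\langle f,p_\ell\rangle_m\,p_\ell$. Efficient hyperinterpolant of $F=Kf$ (with respect to the given factorization into $K$ and $f$): $\mathcal{S}_nF=\sum_{\ell=1}^{d_n}\left(\int_\Omega K(\mathcal{L}_nf)p_\ell\,\mathrm{d}\omega\right)p_\ell$. *)

theory Defs
  imports "HOL-Analysis.Analysis"
begin

section \<open>Regions\<close>

text \<open>\<open>C\<^sup>k\<close> maps on an open set: all iterated directional derivatives up to
  order \<open>k\<close> exist and are continuous.\<close>

primrec Ck_on :: "nat \<Rightarrow> 'a::real_normed_vector set \<Rightarrow> ('a \<Rightarrow> 'b::real_normed_vector) \<Rightarrow> bool" where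
  "Ck_on 0 U g \<longleftrightarrow> continuous_on U g"
| "Ck_on (Suc k) U g \<longleftrightarrow>
     (\<forall>x\<in>U. g differentiable (at x)) \<and> (\<forall>v. Ck_on k U (\<lambda>x. frechet_derivative g (at x) v))"

definition smooth_on :: "'a::real_normed_vector set \<Rightarrow> ('a \<Rightarrow> 'b::real_normed_vector) \<Rightarrow> bool" where
  "smooth_on U g \<longleftrightarrow> (\<forall>k. Ck_on k U g)"

text \<open>A closed manifold is compact and without boundary.  It is given by slice charts: near each of
  its points a diffeomorphism of open subsets of the ambient space maps it onto a coordinate
  subspace of dimension \<open>k\<close>.\<close>

definition smooth_closed_submanifold :: "nat \<Rightarrow> (real^'s) set \<Rightarrow> bool" where
  "smooth_closed_submanifold k \<Omega> \<longleftrightarrow> compact \<Omega> \<and> \<Omega> \<noteq> {} \<and>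
     (\<forall>x\<in>\<Omega>. \<exists>(U :: (real^'s) set) (V :: (real^'s) set) \<phi> \<psi> (I :: 's set). open U \<and> open V \<and> x \<in> U \<and>
        homeomorphism U V \<phi> \<psi> \<and> smooth_on U \<phi> \<and> smooth_on V \<psi> \<and>
        card I = k \<and> \<phi> ` (\<Omega> \<inter> U) = V \<inter> {y. \<forall>i. i \<notin> I \<longrightarrow> y $ i = 0})"

definition region :: "(real^'s) set \<Rightarrow> bool" where
  "region \<Omega> \<longleftrightarrow> bounded \<Omega> \<and>
     ((\<exists>U. open U \<and> connected U \<and> U \<noteq> {} \<and> \<Omega> = closure U) \<or>
      (\<exists>k < CARD('s). smooth_closed_submanifold k \<Omega>))"

text \<open>A finite measure on \<open>\<Omega>\<close> for which the Borel sets are measurable; it need not be complete, so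
  both Borel measures and their completions are covered.\<close>

definition finite_measure_on :: "'a::topological_space set \<Rightarrow> 'a measure \<Rightarrow> bool" where
  "finite_measure_on \<Omega> M \<longleftrightarrow>
     space M = \<Omega> \<and> sets (restrict_space borel \<Omega>) \<subseteq> sets M \<and> finite_measure M"

section \<open>Norms and inner products\<close>

text \<open>Functions on \<open>\<Omega>\<close> are represented by functions on the ambient space of which only the values
  on \<open>\<Omega>\<close> matter.\<close>

definition Lp_norm :: "real \<Rightarrow> 'a measure \<Rightarrow> ('a \<Rightarrow> complex) \<Rightarrow> real" where
  "Lp_norm p M g = (\<integral>x. cmod (g x) powr p \<partial>M) powr (1 / p)"

definition sup_norm :: "'a set \<Rightarrow> ('a \<Rightarrow> complex) \<Rightarrow> real" where
  "sup_norm \<Omega> g = (SUP x\<in>\<Omega>. cmod (g x))"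

definition inner_L2 :: "'a measure \<Rightarrow> ('a \<Rightarrow> complex) \<Rightarrow> ('a \<Rightarrow> complex) \<Rightarrow> complex" where
  "inner_L2 M v z = (\<integral>x. v x * cnj (z x) \<partial>M)"

definition inner_quad ::
  "nat \<Rightarrow> (nat \<Rightarrow> real) \<Rightarrow> (nat \<Rightarrow> 'a) \<Rightarrow> ('a \<Rightarrow> complex) \<Rightarrow> ('a \<Rightarrow> complex) \<Rightarrow> complex" where
  "inner_quad m w x v z = (\<Sum>j=1..m. of_real (w j) * v (x j) * cnj (z (x j)))"

section \<open>Polynomial spaces\<close>

text \<open>The field of scalars, as a subset of the complex numbers.\<close>

definition scalars :: "'a set \<Rightarrow> ('a \<Rightarrow> complex) \<Rightarrow> ('a \<Rightarrow> complex) \<Rightarrow> complex set" where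
  "scalars \<Omega> K f = (if \<forall>x\<in>\<Omega>. K x \<in> \<real> \<and> f x \<in> \<real> then \<real> else UNIV)"

text \<open>Multi-indices are functions \<open>\<alpha> :: 's \<Rightarrow> nat\<close>; the degree is the total degree.\<close>

definition polys :: "complex set \<Rightarrow> (real^'s) set \<Rightarrow> nat \<Rightarrow> (real^'s \<Rightarrow> complex) set" where
  "polys S \<Omega> n = {g. \<exists>c :: ('s \<Rightarrow> nat) \<Rightarrow> complex. range c \<subseteq> S \<and>
     (\<forall>x\<in>\<Omega>. g x = (\<Sum>\<alpha> | (\<Sum>i\<in>UNIV. \<alpha> i) \<le> n. c \<alpha> * (\<Prod>i\<in>UNIV. of_real (x $ i) ^ \<alpha> i)))}"

text \<open>Being a basis determines \<open>d\<close> as the dimension of the polynomial space; linear independence is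
  part of orthonormality.\<close>

definition real_orthonormal_basis ::
  "complex set \<Rightarrow> (real^'s) set \<Rightarrow> (real^'s) measure \<Rightarrow> nat \<Rightarrow> nat \<Rightarrow> (nat \<Rightarrow> real^'s \<Rightarrow> complex) \<Rightarrow> bool"
where
  "real_orthonormal_basis S \<Omega> M n d p \<longleftrightarrow>
     (\<forall>l\<in>{1..d}. p l \<in> polys S \<Omega> n \<and> (\<forall>x\<in>\<Omega>. p l x \<in> \<real>)) \<and>
     (\<forall>k\<in>{1..d}. \<forall>l\<in>{1..d}. inner_L2 M (p k) (p l) = (if k = l then 1 else 0)) \<and>
     (\<forall>g\<in>polys S \<Omega> n. \<exists>a. range a \<subseteq> S \<and> (\<forall>x\<in>\<Omega>. g x = (\<Sum>l=1..d. a l * p l x)))"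

definition best_unif_error ::
  "complex set \<Rightarrow> (real^'s) set \<Rightarrow> nat \<Rightarrow> (real^'s \<Rightarrow> complex) \<Rightarrow> real" where
  "best_unif_error S \<Omega> n f = (INF q\<in>polys S \<Omega> n. sup_norm \<Omega> (\<lambda>x. f x - q x))"

definition best_L1_error ::
  "complex set \<Rightarrow> (real^'s) set \<Rightarrow> (real^'s) measure \<Rightarrow> nat \<Rightarrow> (real^'s \<Rightarrow> complex) \<Rightarrow> real" where
  "best_L1_error S \<Omega> M n g = (INF q\<in>polys S \<Omega> n. Lp_norm 1 M (\<lambda>x. g x - q x))"

definition best_unif_approx ::
  "complex set \<Rightarrow> (real^'s) set \<Rightarrow> nat \<Rightarrow> (real^'s \<Rightarrow> complex) \<Rightarrow> (real^'s \<Rightarrow> complex) \<Rightarrow> bool" where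
  "best_unif_approx S \<Omega> n f q \<longleftrightarrow>
     q \<in> polys S \<Omega> n \<and> sup_norm \<Omega> (\<lambda>x. f x - q x) = best_unif_error S \<Omega> n f"

section \<open>Quadrature\<close>

definition quadrature_rule :: "'a set \<Rightarrow> nat \<Rightarrow> (nat \<Rightarrow> real) \<Rightarrow> (nat \<Rightarrow> 'a) \<Rightarrow> bool" where
  "quadrature_rule \<Omega> m w x \<longleftrightarrow> (\<forall>j\<in>{1..m}. x j \<in> \<Omega> \<and> w j > 0)"

definition exactness_degree ::
  "complex set \<Rightarrow> (real^'s) set \<Rightarrow> (real^'s) measure \<Rightarrow> nat \<Rightarrow> (nat \<Rightarrow> real) \<Rightarrow> (nat \<Rightarrow> real^'s) \<Rightarrow> nat \<Rightarrow> bool"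
where
  "exactness_degree S \<Omega> M m w x N \<longleftrightarrow>
     (\<forall>g\<in>polys S \<Omega> N. (\<Sum>j=1..m. of_real (w j) * g (x j)) = (\<integral>y. g y \<partial>M))"

definition MZ_property ::
  "complex set \<Rightarrow> (real^'s) set \<Rightarrow> (real^'s) measure \<Rightarrow> nat \<Rightarrow> (nat \<Rightarrow> real) \<Rightarrow> (nat \<Rightarrow> real^'s) \<Rightarrow>
    nat \<Rightarrow> nat \<Rightarrow> real \<Rightarrow> bool"
where
  "MZ_property S \<Omega> M m w x n n' \<eta> \<longleftrightarrow> 0 \<le> \<eta> \<and> \<eta> < 1 \<and> (n' = n \<longrightarrow> \<eta> = 0) \<and>
     (\<forall>q :: real^'s \<Rightarrow> real. (\<lambda>y. of_real (q y)) \<in> polys S \<Omega> n \<longrightarrow>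
        \<bar>(\<Sum>j=1..m. w j * (q (x j))\<^sup>2) - (\<integral>y. (q y)\<^sup>2 \<partial>M)\<bar> \<le> \<eta> * (\<integral>y. (q y)\<^sup>2 \<partial>M))"

section \<open>Hyperinterpolation\<close>

definition hyperinterpolant ::
  "nat \<Rightarrow> (nat \<Rightarrow> real) \<Rightarrow> (nat \<Rightarrow> 'a) \<Rightarrow> nat \<Rightarrow> (nat \<Rightarrow> 'a \<Rightarrow> complex) \<Rightarrow> ('a \<Rightarrow> complex) \<Rightarrow> 'a \<Rightarrow> complex"
where
  "hyperinterpolant m w x d p f = (\<lambda>y. \<Sum>l=1..d. inner_quad m w x f (p l) * p l y)"

text \<open>The efficient hyperinterpolant of \<open>F = K f\<close> depends on the factors, not only on \<open>F\<close>.\<close>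

definition efficient_hyperinterpolant ::
  "'a measure \<Rightarrow> nat \<Rightarrow> (nat \<Rightarrow> real) \<Rightarrow> (nat \<Rightarrow> 'a) \<Rightarrow> nat \<Rightarrow> (nat \<Rightarrow> 'a \<Rightarrow> complex) \<Rightarrow>
    ('a \<Rightarrow> complex) \<Rightarrow> ('a \<Rightarrow> complex) \<Rightarrow> 'a \<Rightarrow> complex"
where
  "efficient_hyperinterpolant M m w x d p K f =
     (\<lambda>y. \<Sum>l=1..d. (\<integral>t. K t * hyperinterpolant m w x d p f t * p l t \<partial>M) * p l y)"

definition modified_moment ::
  "'a measure \<Rightarrow> (nat \<Rightarrow> 'a \<Rightarrow> complex) \<Rightarrow> ('a \<Rightarrow> complex) \<Rightarrow> nat \<Rightarrow> nat \<Rightarrow> complex" where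
  "modified_moment M p K l' l = (\<integral>y. K y * p l' y * p l y \<partial>M)"

definition A_const :: "'a measure \<Rightarrow> nat \<Rightarrow> (nat \<Rightarrow> 'a \<Rightarrow> complex) \<Rightarrow> ('a \<Rightarrow> complex) \<Rightarrow> real" where
  "A_const M d p K = sqrt (\<Sum>l=1..d. \<Sum>l'=1..d. (cmod (modified_moment M p K l' l))\<^sup>2)"

end

theory Submission
  imports Defs
begin

text \<open>Write \<open>c\<close> for the coefficients of \<open>\<L>\<^sub>n f\<close>.  Then \<open>\<Sum>\<bar>c\<^sub>l\<bar>\<^sup>2 = \<langle>f, \<L>\<^sub>n f\<rangle>\<^sub>m\<close>, so the Cauchy--Schwarz inequality
  for the quadrature rule and the Marcinkiewicz--Zygmund property, applied to the real and
  imaginary parts of \<open>\<L>\<^sub>n f\<close>, give \<open>\<parallel>c\<parallel>\<^sub>2 \<le> sqrt (V (1 + \<eta>)) \<parallel>f\<parallel>\<^sub>\<infinity>\<close>, where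
  \<open>1 + \<eta> \<le> 1 / (1 - \<eta>)\<close>.  The coefficients of \<open>\<S>\<^sub>n F\<close> are obtained from \<open>c\<close> by the matrix of the
  modified moments, whose Frobenius norm is \<open>A\<^sub>n\<close>.  For the error, \<open>\<L>\<^sub>n\<close> reproduces \<open>\<chi>\<^sup>* \<in> \<P>\<^sub>n\<^sub>'\<close> by
  exactness, so \<open>\<S>\<^sub>n (K \<chi>\<^sup>*)\<close> is the orthogonal projection of \<open>K \<chi>\<^sup>*\<close> to \<open>\<P>\<^sub>n\<close>; that projection fixes
  \<open>\<P>\<^sub>n\<close> and is bounded on \<open>L\<^sup>1\<close> with norm at most \<open>V\<^sup>1\<^sup>/\<^sup>2 \<Sum>\<parallel>p\<^sub>l\<parallel>\<^sub>\<infinity>\<close>.\<close>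

section \<open>Polynomial spaces\<close>

definition monomial_fun :: "('s \<Rightarrow> nat) \<Rightarrow> real^'s \<Rightarrow> complex" where
  "monomial_fun \<alpha> x = (\<Prod>i\<in>UNIV. of_real (x $ i) ^ \<alpha> i)"

lemma polys_iff:
  "g \<in> polys S \<Omega> n \<longleftrightarrow> (\<exists>c. range c \<subseteq> S \<and>
     (\<forall>x\<in>\<Omega>. g x = (\<Sum>\<alpha> | sum \<alpha> UNIV \<le> n. c \<alpha> * monomial_fun \<alpha> x)))"
  by (simp add: polys_def monomial_fun_def)

lemma polysI:
  assumes "range c \<subseteq> S"
    and "\<And>x. x \<in> \<Omega> \<Longrightarrow> g x = (\<Sum>\<alpha> | sum \<alpha> UNIV \<le> n. c \<alpha> * monomial_fun \<alpha> x)"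
  shows "g \<in> polys S \<Omega> n"
  unfolding polys_iff using assms by (intro exI[of _ c] conjI ballI)

text \<open>Each entry is at most the total degree, so the indices lie in a finite box. Sums over
  infinite sets are 0 by convention; finiteness is what lets \<open>monomial_fun_in_polys\<close>
  pick out a single term.\<close>

lemma finite_multi_indices: "finite {\<alpha> :: 's::finite \<Rightarrow> nat. sum \<alpha> UNIV \<le> n}"
proof (rule finite_subset)
  show "{\<alpha> :: 's \<Rightarrow> nat. sum \<alpha> UNIV \<le> n} \<subseteq> (\<Pi>\<^sub>E i\<in>UNIV. {..n})"
  proof
    fix \<alpha> :: "'s \<Rightarrow> nat"
    assume "\<alpha> \<in> {\<alpha>. sum \<alpha> UNIV \<le> n}"
    moreover have "\<alpha> i \<le> sum \<alpha> UNIV" for i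
      using member_le_sum[of i UNIV \<alpha>] by simp
    ultimately have "\<alpha> i \<le> n" for i
      using order_trans[of "\<alpha> i" "sum \<alpha> UNIV" n] by simp
    then show "\<alpha> \<in> (\<Pi>\<^sub>E i\<in>UNIV. {..n})"
      by (simp add: PiE_UNIV_domain)
  qed
qed (auto intro: finite_PiE)

lemma monomial_fun_mult: "monomial_fun \<alpha> x * monomial_fun \<beta> x = monomial_fun (\<lambda>i. \<alpha> i + \<beta> i) x"
  by (simp add: monomial_fun_def power_add prod.distrib)

text \<open>Functions live on the whole ambient space, but membership looks only at values on
  \<Omega>. This permits rewriting, for instance, \<open>cnj (p l y)\<close> to \<open>p l y\<close>
  inside a polynomial.\<close>

lemma polys_cong: "g \<in> polys S \<Omega> n \<Longrightarrow> (\<And>x. x \<in> \<Omega> \<Longrightarrow> h x = g x) \<Longrightarrow> h \<in> polys S \<Omega> n"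
  by (auto simp: polys_iff)

lemma continuous_on_polys:
  assumes "g \<in> polys S \<Omega> n"
  shows "continuous_on \<Omega> g"
proof -
  obtain c where "range c \<subseteq> S" and "\<forall>x\<in>\<Omega>. g x = (\<Sum>\<alpha> | sum \<alpha> UNIV \<le> n. c \<alpha> * monomial_fun \<alpha> x)"
    using assms unfolding polys_iff by blast
  then have "continuous_on \<Omega> g \<longleftrightarrow>
      continuous_on \<Omega> (\<lambda>x. \<Sum>\<alpha> | sum \<alpha> UNIV \<le> n. c \<alpha> * monomial_fun \<alpha> x)"
    by (intro continuous_on_cong) auto
  also have \<dots>
    unfolding monomial_fun_def by (intro continuous_on_sum continuous_on_mult continuous_on_prod continuous_on_power
        continuous_on_of_real continuous_on_component continuous_on_const continuous_on_id)
  finally show ?thesis .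
qed

text \<open>Later arguments use the scalar field only through closure under sums and products and
  containment of the reals, so one proof serves the real and the complex case.\<close>

locale polynomial_scalars =
  fixes S :: "complex set"
  assumes scalars_cases: "S = \<real> \<or> S = UNIV"
begin

lemma scalars_add: "a \<in> S \<Longrightarrow> b \<in> S \<Longrightarrow> a + b \<in> S"
  and scalars_mult: "a \<in> S \<Longrightarrow> b \<in> S \<Longrightarrow> a * b \<in> S"
  and scalars_of_real: "of_real r \<in> S"
  using scalars_cases by auto

lemma scalars_0: "0 \<in> S" and scalars_1: "1 \<in> S"
  using scalars_of_real[of 0] scalars_of_real[of 1] by auto

section \<open>Algebraic closure of the polynomial spaces\<close>

lemma polys_add:
  assumes "g \<in> polys S \<Omega> n" and "h \<in> polys S \<Omega> n"
  shows "(\<lambda>x. g x + h x) \<in> polys S \<Omega> n"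
proof -
  obtain a where a: "range a \<subseteq> S"
    and g: "\<forall>x\<in>\<Omega>. g x = (\<Sum>\<alpha> | sum \<alpha> UNIV \<le> n. a \<alpha> * monomial_fun \<alpha> x)"
    using assms(1) unfolding polys_iff by blast
  obtain b where b: "range b \<subseteq> S"
    and h: "\<forall>x\<in>\<Omega>. h x = (\<Sum>\<alpha> | sum \<alpha> UNIV \<le> n. b \<alpha> * monomial_fun \<alpha> x)"
    using assms(2) unfolding polys_iff by blast
  show ?thesis
  proof (rule polysI)
    show "range (\<lambda>\<alpha>. a \<alpha> + b \<alpha>) \<subseteq> S"
      using a b by (auto intro: scalars_add)
    show "g x + h x = (\<Sum>\<alpha> | sum \<alpha> UNIV \<le> n. (a \<alpha> + b \<alpha>) * monomial_fun \<alpha> x)" if "x \<in> \<Omega>" for x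
      by (simp only: g[rule_format, OF that] h[rule_format, OF that] sum.distrib distrib_right)
  qed
qed

lemma polys_cmult:
  assumes "g \<in> polys S \<Omega> n" and "r \<in> S"
  shows "(\<lambda>x. r * g x) \<in> polys S \<Omega> n"
proof -
  obtain a where a: "range a \<subseteq> S"
    and g: "\<forall>x\<in>\<Omega>. g x = (\<Sum>\<alpha> | sum \<alpha> UNIV \<le> n. a \<alpha> * monomial_fun \<alpha> x)"
    using assms(1) unfolding polys_iff by blast
  show ?thesis
  proof (rule polysI)
    show "range (\<lambda>\<alpha>. r * a \<alpha>) \<subseteq> S"
      using a assms(2) by (auto intro: scalars_mult)
    show "r * g x = (\<Sum>\<alpha> | sum \<alpha> UNIV \<le> n. (r * a \<alpha>) * monomial_fun \<alpha> x)" if "x \<in> \<Omega>" for x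
      by (simp only: g[rule_format, OF that] sum_distrib_left mult.assoc)
  qed
qed

lemma polys_zero: "(\<lambda>x. 0) \<in> polys S \<Omega> n"
  by (rule polysI[of "\<lambda>_. 0"]) (auto simp: scalars_0)

lemma polys_sum:
  assumes "\<And>i. i \<in> I \<Longrightarrow> g i \<in> polys S \<Omega> n"
  shows "(\<lambda>x. \<Sum>i\<in>I. g i x) \<in> polys S \<Omega> n"
  using assms
proof (induction I rule: infinite_finite_induct)
  case (insert i I)
  then have "(\<lambda>x. g i x + (\<Sum>i\<in>I. g i x)) \<in> polys S \<Omega> n"
    by (intro polys_add) simp_all
  then show ?case
    using insert.hyps by simp
qed (simp_all add: polys_zero)

lemma sum_delta_mult:
  fixes g :: "'b \<Rightarrow> 'c::semiring_1"
  assumes "finite A" and "a \<in> A"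
  shows "(\<Sum>b\<in>A. (if b = a then 1 else 0) * g b) = g a"
  using assms by (simp add: if_distrib[of "\<lambda>t. t * _"] sum.delta cong: if_cong)

lemma monomial_fun_in_polys:
  assumes "sum \<alpha> UNIV \<le> n"
  shows "monomial_fun \<alpha> \<in> polys S \<Omega> n"
proof (rule polysI)
  show "range (\<lambda>\<beta>. if \<beta> = \<alpha> then 1 else 0) \<subseteq> S"
    using scalars_0 scalars_1 by auto
  show "monomial_fun \<alpha> x = (\<Sum>\<beta> | sum \<beta> UNIV \<le> n. (if \<beta> = \<alpha> then 1 else 0) * monomial_fun \<beta> x)" for x
    using sum_delta_mult[OF finite_multi_indices, of \<alpha> n "\<lambda>\<beta>. monomial_fun \<beta> x"] assms by (metis mem_Collect_eq)
qed

lemma polys_one: "(\<lambda>x. 1) \<in> polys S \<Omega> n"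
  using monomial_fun_in_polys[of "\<lambda>_. 0" n] by (rule polys_cong) (simp_all add: monomial_fun_def)

lemma polys_mono:
  assumes "g \<in> polys S \<Omega> k" and "k \<le> n"
  shows "g \<in> polys S \<Omega> n"
proof -
  obtain a where a: "range a \<subseteq> S"
    and g: "\<forall>x\<in>\<Omega>. g x = (\<Sum>\<alpha> | sum \<alpha> UNIV \<le> k. a \<alpha> * monomial_fun \<alpha> x)"
    using assms(1) unfolding polys_iff by blast
  have "(\<lambda>x. \<Sum>\<alpha> | sum \<alpha> UNIV \<le> k. a \<alpha> * monomial_fun \<alpha> x) \<in> polys S \<Omega> n"
    using a assms(2) by (intro polys_sum polys_cmult monomial_fun_in_polys) auto
  then show ?thesis
    by (rule polys_cong) (simp add: g)
qed

text \<open>Additivity of degrees is what matches the exactness degree \<open>n + n'\<close>: a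
  basis element times a polynomial of degree \<open>n'\<close> is integrated exactly by the
  rule.\<close>

lemma polys_mult:
  assumes "g \<in> polys S \<Omega> k" and "h \<in> polys S \<Omega> n"
  shows "(\<lambda>x. g x * h x) \<in> polys S \<Omega> (k + n)"
proof -
  obtain a where a: "range a \<subseteq> S"
    and g: "\<forall>x\<in>\<Omega>. g x = (\<Sum>\<alpha> | sum \<alpha> UNIV \<le> k. a \<alpha> * monomial_fun \<alpha> x)"
    using assms(1) unfolding polys_iff by blast
  obtain b where b: "range b \<subseteq> S"
    and h: "\<forall>x\<in>\<Omega>. h x = (\<Sum>\<beta> | sum \<beta> UNIV \<le> n. b \<beta> * monomial_fun \<beta> x)"
    using assms(2) unfolding polys_iff by blast
  have "(\<lambda>x. \<Sum>\<alpha> | sum \<alpha> UNIV \<le> k. \<Sum>\<beta> | sum \<beta> UNIV \<le> n.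
      (a \<alpha> * b \<beta>) * monomial_fun (\<lambda>i. \<alpha> i + \<beta> i) x) \<in> polys S \<Omega> (k + n)"
    using a b by (intro polys_sum polys_cmult monomial_fun_in_polys scalars_mult)
      (auto simp: sum.distrib add_mono)
  moreover have "g x * h x = (\<Sum>\<alpha> | sum \<alpha> UNIV \<le> k. \<Sum>\<beta> | sum \<beta> UNIV \<le> n.
      (a \<alpha> * b \<beta>) * monomial_fun (\<lambda>i. \<alpha> i + \<beta> i) x)" if "x \<in> \<Omega>" for x
    unfolding g[rule_format, OF that] h[rule_format, OF that] sum_product
      monomial_fun_mult[symmetric] by (intro sum.cong refl) (simp only: mult_ac)
  ultimately show ?thesis
    by (rule polys_cong)
qed

end

section \<open>Integration on a compact region\<close>

lemma compact_region: "region \<Omega> \<Longrightarrow> compact \<Omega>"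
  by (auto simp: region_def smooth_closed_submanifold_def compact_eq_bounded_closed)

lemma region_nonempty: "region \<Omega> \<Longrightarrow> \<Omega> \<noteq> {}"
  unfolding region_def smooth_closed_submanifold_def using closure_eq_empty by metis

text \<open>Cauchy--Schwarz against the constant 1, obtained from the nonnegative integral of
  \<open>(V * h x - I)\<^sup>2\<close>. Scaling by \<open>V\<close>, rather than subtracting the
  mean \<open>I / V\<close>, avoids a division when \<open>V\<close> may vanish.\<close>

lemma (in finite_measure) integral_le_sqrt_integral_square:
  fixes h :: "'a \<Rightarrow> real"
  assumes h: "integrable M h" and h2: "integrable M (\<lambda>x. (h x)\<^sup>2)"
  shows "(\<integral>x. h x \<partial>M) \<le> sqrt (measure M (space M)) * sqrt (\<integral>x. (h x)\<^sup>2 \<partial>M)"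
proof -
  define V I J where "V = measure M (space M)" and "I = (\<integral>x. h x \<partial>M)" and "J = (\<integral>x. (h x)\<^sup>2 \<partial>M)"
  have "V \<ge> 0" "J \<ge> 0"
    by (simp_all add: V_def J_def)
  have "0 \<le> (\<integral>x. (V * h x - I)\<^sup>2 \<partial>M)"
    by simp
  also have "\<dots> = (\<integral>x. V\<^sup>2 * (h x)\<^sup>2 - 2 * V * I * h x + I\<^sup>2 \<partial>M)"
    by (intro Bochner_Integration.integral_cong) (auto simp: power2_eq_square algebra_simps)
  also have "\<dots> = V\<^sup>2 * J - 2 * V * I * I + V * I\<^sup>2"
    using h h2 by (simp add: V_def[symmetric] I_def[symmetric] J_def[symmetric])
  also have "\<dots> = V * (V * J - I\<^sup>2)"
    by (simp add: power2_eq_square algebra_simps)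
  finally have *: "0 \<le> V * (V * J - I\<^sup>2)" .
  have "I\<^sup>2 \<le> V * J"
  \<comment> \<open>For \<open>V = 0\<close> the inequality \<open>*\<close> carries no information;
    then \<open>M\<close> is the null measure and \<open>I\<close> vanishes.\<close>
  proof (cases "V = 0")
    case True
    then have "AE x in M. False"
      by (intro AE_I[of _ _ "space M"]) (auto simp: V_def emeasure_eq_measure)
    then have "I = 0"
      unfolding I_def by (intro integral_eq_zero_AE) auto
    then show ?thesis using True by simp
  next
    case False
    with \<open>V \<ge> 0\<close> * show ?thesis by (simp add: zero_le_mult_iff)
  qed
  then have "I \<le> sqrt (V * J)"
    by (simp add: real_le_rsqrt)
  then show ?thesis
    by (simp add: V_def I_def J_def real_sqrt_mult)
qed

locale compact_measure = finite_measure M for M :: "'a::topological_space measure" +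
  fixes \<Omega> :: "'a set"
  assumes compact: "compact \<Omega>" and nonempty: "\<Omega> \<noteq> {}"
    and space_eq: "space M = \<Omega>"
    and sets_subset: "sets (restrict_space borel \<Omega>) \<subseteq> sets M"
begin

section \<open>Sup norm and integrability of continuous functions\<close>

lemma cmod_le_sup_norm:
  assumes "continuous_on \<Omega> g" and "x \<in> \<Omega>"
  shows "cmod (g x) \<le> sup_norm \<Omega> g"
proof -
  \<comment> \<open>The real supremum is known to be an upper bound only for a set bounded above;
    compactness supplies this.\<close>
  have "bounded ((\<lambda>x. cmod (g x)) ` \<Omega>)"
    using assms(1) compact by (intro compact_imp_bounded compact_continuous_image continuous_intros)
  then show ?thesis
    unfolding sup_norm_def using assms(2) by (intro cSUP_upper bounded_imp_bdd_above)
qed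

text \<open>A point of \<Omega> is required, since the real supremum over the empty set carries no
  sign information.\<close>

lemma sup_norm_nonneg:
  assumes "continuous_on \<Omega> g"
  shows "0 \<le> sup_norm \<Omega> g"
proof -
  obtain x where "x \<in> \<Omega>"
    using nonempty by blast
  then show ?thesis
    using order_trans[OF norm_ge_zero cmod_le_sup_norm[OF assms]] by blast
qed

text \<open>Continuity on \<Omega> gives measurability for the trace Borel sets, and enlarging the
  sigma-algebra of the domain to that of \<open>M\<close> preserves it.\<close>

lemma continuous_measurable:
  fixes g :: "'a \<Rightarrow> complex"
  assumes "continuous_on \<Omega> g"
  shows "g \<in> borel_measurable M"
proof -
  have "measurable (restrict_space borel \<Omega>) borel \<subseteq> measurable M (borel :: complex measure)"
    using sets_subset by (intro measurable_mono) (auto simp: space_eq space_restrict_space)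
  then show ?thesis
    using borel_measurable_continuous_on_restrict[OF assms] by blast
qed

text \<open>\<open>K\<close> is merely integrable, so every integrand below is arranged as an
  integrable function times a continuous, hence bounded, one.\<close>

lemma integrable_mult_continuous:
  fixes k :: "'a \<Rightarrow> complex"
  assumes "integrable M k" and "continuous_on \<Omega> g"
  shows "integrable M (\<lambda>x. k x * g x)"
proof (rule Bochner_Integration.integrable_bound)
  show "integrable M (\<lambda>x. of_real (sup_norm \<Omega> g) * k x)"
    using assms(1) by simp
  show "(\<lambda>x. k x * g x) \<in> borel_measurable M"
    using assms continuous_measurable by (intro borel_measurable_times) auto
  show "AE x in M. norm (k x * g x) \<le> norm (of_real (sup_norm \<Omega> g) * k x)"
  proof (rule AE_I2)
    fix x assume "x \<in> space M"
    then have "cmod (g x) * cmod (k x) \<le> sup_norm \<Omega> g * cmod (k x)"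
      by (intro mult_right_mono cmod_le_sup_norm[OF assms(2)]) (simp_all add: space_eq)
    then show "norm (k x * g x) \<le> norm (of_real (sup_norm \<Omega> g) * k x)"
      using sup_norm_nonneg[OF assms(2)] by (simp add: norm_mult mult.commute)
  qed
qed

lemma integrable_continuous:
  fixes g :: "'a \<Rightarrow> complex"
  assumes "continuous_on \<Omega> g"
  shows "integrable M g"
  using integrable_mult_continuous[of "\<lambda>_. 1", OF _ assms] by simp

lemma integral_eqI:
  fixes g h :: "'a \<Rightarrow> 'b::{banach, second_countable_topology}"
  assumes "\<And>x. x \<in> \<Omega> \<Longrightarrow> g x = h x"
  shows "(\<integral>x. g x \<partial>M) = (\<integral>x. h x \<partial>M)"
  using assms by (intro Bochner_Integration.integral_cong) (auto simp: space_eq)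

section \<open>Norm inequalities\<close>

lemma Lp_norm_1: "Lp_norm 1 M g = (\<integral>x. cmod (g x) \<partial>M)"
  by (simp add: Lp_norm_def)

lemma Lp_norm_2: "Lp_norm 2 M g = sqrt (\<integral>x. (cmod (g x))\<^sup>2 \<partial>M)"
  by (simp add: Lp_norm_def powr_half_sqrt)

lemma Lp_norm_1_cong: "(\<And>x. x \<in> \<Omega> \<Longrightarrow> g x = h x) \<Longrightarrow> Lp_norm 1 M g = Lp_norm 1 M h"
  unfolding Lp_norm_1 by (rule integral_eqI) simp

lemma Lp_norm_1_add:
  assumes "integrable M g" and "integrable M h"
  shows "Lp_norm 1 M (\<lambda>x. g x + h x) \<le> Lp_norm 1 M g + Lp_norm 1 M h"
proof -
  have "(\<integral>x. cmod (g x + h x) \<partial>M) \<le> (\<integral>x. cmod (g x) + cmod (h x) \<partial>M)"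
    using assms by (intro integral_mono) (simp_all add: norm_triangle_ineq)
  then show ?thesis
    unfolding Lp_norm_1 using assms by simp
qed

lemma Lp_norm_1_uminus: "Lp_norm 1 M (\<lambda>x. - g x) = Lp_norm 1 M g"
  by (simp add: Lp_norm_1)

lemma Lp_norm_1_diff:
  assumes "integrable M g" and "integrable M h"
  shows "Lp_norm 1 M (\<lambda>x. g x - h x) \<le> Lp_norm 1 M g + Lp_norm 1 M h"
  using Lp_norm_1_add[OF assms(1), of "\<lambda>x. - h x"] assms(2) Lp_norm_1_uminus[of h] by simp

lemma Lp_norm_1_mult_sup_norm:
  assumes "integrable M k" and "continuous_on \<Omega> g"
  shows "Lp_norm 1 M (\<lambda>x. k x * g x) \<le> Lp_norm 1 M k * sup_norm \<Omega> g"
proof -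
  have "Lp_norm 1 M (\<lambda>x. k x * g x) \<le> (\<integral>x. cmod (k x) * sup_norm \<Omega> g \<partial>M)"
    unfolding Lp_norm_1
  proof (rule integral_mono)
    show "integrable M (\<lambda>x. cmod (k x * g x))"
      using integrable_mult_continuous[OF assms] by (rule integrable_norm)
    show "integrable M (\<lambda>x. cmod (k x) * sup_norm \<Omega> g)"
      using assms(1) by simp
    show "cmod (k x * g x) \<le> cmod (k x) * sup_norm \<Omega> g" if "x \<in> space M" for x
      unfolding norm_mult using that
      by (intro mult_left_mono cmod_le_sup_norm[OF assms(2)]) (simp_all add: space_eq)
  qed
  then show ?thesis
    by (simp add: Lp_norm_1)
qed

lemma Lp_norm_1_le_Lp_norm_2:
  assumes "continuous_on \<Omega> g"
  shows "Lp_norm 1 M g \<le> sqrt (measure M \<Omega>) * Lp_norm 2 M g"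
proof -
  have "integrable M (\<lambda>x. cmod ((g x)\<^sup>2))"
    using assms by (intro integrable_norm integrable_continuous continuous_on_power)
  then have "integrable M (\<lambda>x. (cmod (g x))\<^sup>2)"
    by (simp add: norm_power)
  with integrable_norm[OF integrable_continuous[OF assms]]
  show ?thesis
    unfolding Lp_norm_1 Lp_norm_2 space_eq[symmetric] by (rule integral_le_sqrt_integral_square)
qed

end

section \<open>Orthonormal bases\<close>

locale orthonormal_polynomials = compact_measure M \<Omega> + polynomial_scalars S
  for M :: "(real^'s) measure" and \<Omega> S +
  fixes n d :: nat and p :: "nat \<Rightarrow> real^'s \<Rightarrow> complex"
  assumes basis: "real_orthonormal_basis S \<Omega> M n d p"
begin

lemma basis_in_polys: "l \<in> {1..d} \<Longrightarrow> p l \<in> polys S \<Omega> n"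
  and basis_orthonormal: "k \<in> {1..d} \<Longrightarrow> l \<in> {1..d} \<Longrightarrow> inner_L2 M (p k) (p l) = (if k = l then 1 else 0)"
  using basis unfolding real_orthonormal_basis_def by blast+

lemma basis_in_Reals: "l \<in> {1..d} \<Longrightarrow> y \<in> \<Omega> \<Longrightarrow> p l y \<in> \<real>"
  using basis unfolding real_orthonormal_basis_def by blast

lemma cnj_basis: "l \<in> {1..d} \<Longrightarrow> y \<in> \<Omega> \<Longrightarrow> cnj (p l y) = p l y"
  using basis_in_Reals by (simp add: Reals_cnj_iff)

lemma continuous_on_basis: "l \<in> {1..d} \<Longrightarrow> continuous_on \<Omega> (p l)"
  by (rule continuous_on_polys[OF basis_in_polys])

lemma continuous_on_combination: "continuous_on \<Omega> (\<lambda>y. \<Sum>l=1..d. a l * p l y)"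
  by (intro continuous_on_sum continuous_on_mult continuous_on_const continuous_on_basis)

lemma inner_L2_combination:
  assumes "k \<in> {1..d}"
  shows "inner_L2 M (\<lambda>y. \<Sum>l=1..d. a l * p l y) (p k) = a k"
proof -
  have int: "integrable M (\<lambda>y. p l y * cnj (p k y))" if "l \<in> {1..d}" for l
    using that assms by (intro integrable_continuous continuous_on_mult continuous_on_cnj continuous_on_basis)
  have "inner_L2 M (\<lambda>y. \<Sum>l=1..d. a l * p l y) (p k) = (\<integral>y. (\<Sum>l=1..d. a l * (p l y * cnj (p k y))) \<partial>M)"
    unfolding inner_L2_def sum_distrib_right mult.assoc ..
  also have "\<dots> = (\<Sum>l=1..d. a l * inner_L2 M (p l) (p k))"
    unfolding inner_L2_def using int by (subst Bochner_Integration.integral_sum) simp_all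
  also have "\<dots> = (\<Sum>l=1..d. if l = k then a l else 0)"
    using assms by (intro sum.cong refl) (simp add: basis_orthonormal)
  finally show ?thesis
    using assms by simp
qed

text \<open>Spanning yields some coefficients, and orthonormality forces them to be the inner
  products. Hence the orthogonal projection is the identity on the polynomial space.\<close>

lemma polys_expansion:
  assumes "g \<in> polys S \<Omega> n" and "y \<in> \<Omega>"
  shows "(\<Sum>l=1..d. inner_L2 M g (p l) * p l y) = g y"
proof -
  obtain a where a: "\<forall>y\<in>\<Omega>. g y = (\<Sum>l=1..d. a l * p l y)"
    using basis assms(1) unfolding real_orthonormal_basis_def by blast
  have "inner_L2 M g (p k) = a k" if "k \<in> {1..d}" for k
  proof -
    have "inner_L2 M g (p k) = inner_L2 M (\<lambda>y. \<Sum>l=1..d. a l * p l y) (p k)"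
      unfolding inner_L2_def using a by (intro integral_eqI) simp
    then show ?thesis
      using inner_L2_combination[OF that] by simp
  qed
  then show ?thesis
    using a assms(2) by simp
qed

text \<open>Parseval's identity. Only the conjugated factor is expanded; the inner products with the
  intact \<open>g\<close> are its coefficients by \<open>inner_L2_combination\<close>, so no double
  sum arises.\<close>

lemma integral_norm_combination:
  "(\<integral>y. (cmod (\<Sum>l=1..d. a l * p l y))\<^sup>2 \<partial>M) = (L2_set (\<lambda>l. cmod (a l)) {1..d})\<^sup>2"
proof -
  define g where "g = (\<lambda>y. \<Sum>l=1..d. a l * p l y)"
  have int: "integrable M (\<lambda>y. g y * cnj (p l y))" if "l \<in> {1..d}" for l
    using that unfolding g_def
    by (intro integrable_continuous continuous_on_mult continuous_on_cnj continuous_on_basis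
        continuous_on_combination)
  have "complex_of_real (\<integral>y. (cmod (g y))\<^sup>2 \<partial>M) = (\<integral>y. g y * cnj (g y) \<partial>M)"
    by (simp add: complex_norm_square[symmetric] flip: integral_complex_of_real)
  also have "\<dots> = (\<integral>y. (\<Sum>l=1..d. cnj (a l) * (g y * cnj (p l y))) \<partial>M)"
    by (simp add: g_def sum_distrib_left mult_ac)
  also have "\<dots> = (\<Sum>l=1..d. cnj (a l) * inner_L2 M g (p l))"
    unfolding inner_L2_def using int by (subst Bochner_Integration.integral_sum) simp_all
  also have "\<dots> = (\<Sum>l=1..d. of_real ((cmod (a l))\<^sup>2))"
    by (intro sum.cong refl)
      (simp only: g_def inner_L2_combination complex_norm_square mult.commute)
  also have "\<dots> = of_real (\<Sum>l=1..d. (cmod (a l))\<^sup>2)"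
    by simp
  finally have "(\<integral>y. (cmod (g y))\<^sup>2 \<partial>M) = (\<Sum>l=1..d. (cmod (a l))\<^sup>2)"
    by (simp only: of_real_eq_iff)
  then show ?thesis
    by (simp add: g_def L2_set_def sum_nonneg)
qed

lemma Lp_norm_2_combination:
  "Lp_norm 2 M (\<lambda>y. \<Sum>l=1..d. a l * p l y) = L2_set (\<lambda>l. cmod (a l)) {1..d}"
  unfolding Lp_norm_2 integral_norm_combination by simp

lemma Lp_norm_2_basis:
  assumes "k \<in> {1..d}"
  shows "Lp_norm 2 M (p k) = 1"
proof -
  have "complex_of_real (\<integral>y. (cmod (p k y))\<^sup>2 \<partial>M) = inner_L2 M (p k) (p k)"
    unfolding inner_L2_def
    by (simp add: complex_norm_square[symmetric] flip: integral_complex_of_real)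
  also have "\<dots> = of_real 1"
    using basis_orthonormal[OF assms assms] by simp
  finally show ?thesis
    unfolding Lp_norm_2 of_real_eq_iff by simp
qed

section \<open>The orthogonal projection in the L1 norm\<close>

lemma Lp_norm_1_combination:
  "Lp_norm 1 M (\<lambda>y. \<Sum>l=1..d. a l * p l y) \<le> sqrt (measure M \<Omega>) * (\<Sum>l=1..d. cmod (a l))"
proof -
  have int: "integrable M (p l)" if "l \<in> {1..d}" for l
    using that by (intro integrable_continuous continuous_on_basis)
  have "Lp_norm 1 M (\<lambda>y. \<Sum>l=1..d. a l * p l y) \<le> (\<integral>y. (\<Sum>l=1..d. cmod (a l) * cmod (p l y)) \<partial>M)"
    unfolding Lp_norm_1
  proof (rule integral_mono)
    show "integrable M (\<lambda>y. cmod (\<Sum>l=1..d. a l * p l y))"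
      by (intro integrable_norm integrable_continuous continuous_on_combination)
    show "integrable M (\<lambda>y. \<Sum>l=1..d. cmod (a l) * cmod (p l y))"
      using int by (intro Bochner_Integration.integrable_sum integrable_mult_right integrable_norm)
    show "cmod (\<Sum>l=1..d. a l * p l y) \<le> (\<Sum>l=1..d. cmod (a l) * cmod (p l y))" for y
      using norm_sum[of "\<lambda>l. a l * p l y" "{1..d}"] by (simp add: norm_mult)
  qed
  also have "\<dots> = (\<Sum>l=1..d. cmod (a l) * Lp_norm 1 M (p l))"
    unfolding Lp_norm_1 using int by (subst Bochner_Integration.integral_sum) simp_all
  \<comment> \<open>The factor \<open>sqrt V\<close> arises here: each basis element has L2 norm 1,
    so its L1 norm is at most \<open>sqrt V\<close>.\<close>
  also have "\<dots> \<le> (\<Sum>l=1..d. cmod (a l) * sqrt (measure M \<Omega>))"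
  proof (intro sum_mono mult_left_mono)
    show "Lp_norm 1 M (p l) \<le> sqrt (measure M \<Omega>)" if "l \<in> {1..d}" for l
      using Lp_norm_1_le_Lp_norm_2[OF continuous_on_basis[OF that]] Lp_norm_2_basis[OF that] by simp
  qed simp
  finally show ?thesis
    by (simp add: sum_distrib_left mult.commute)
qed

text \<open>Hoelder's inequality with exponents 1 and infinity, since \<open>h\<close> need not be
  square integrable. This is the source of the sup norms of the basis in the error constant.\<close>

lemma cmod_inner_L2_basis_le:
  assumes "integrable M h" and "l \<in> {1..d}"
  shows "cmod (inner_L2 M h (p l)) \<le> Lp_norm 1 M h * sup_norm \<Omega> (p l)"
proof -
  have "cmod (inner_L2 M h (p l)) \<le> Lp_norm 1 M (\<lambda>y. h y * cnj (p l y))"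
    unfolding inner_L2_def Lp_norm_1 by (rule integral_norm_bound)
  also have "\<dots> \<le> Lp_norm 1 M h * sup_norm \<Omega> (\<lambda>y. cnj (p l y))"
    using assms by (intro Lp_norm_1_mult_sup_norm continuous_on_cnj continuous_on_basis)
  finally show ?thesis
    by (simp add: sup_norm_def)
qed

lemma Lp_norm_1_projection:
  assumes "integrable M h"
  shows "Lp_norm 1 M (\<lambda>y. \<Sum>l=1..d. inner_L2 M h (p l) * p l y)
    \<le> sqrt (measure M \<Omega>) * (\<Sum>l=1..d. sup_norm \<Omega> (p l)) * Lp_norm 1 M h"
proof -
  have "Lp_norm 1 M (\<lambda>y. \<Sum>l=1..d. inner_L2 M h (p l) * p l y)
      \<le> sqrt (measure M \<Omega>) * (\<Sum>l=1..d. cmod (inner_L2 M h (p l)))"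
    by (rule Lp_norm_1_combination)
  also have "\<dots> \<le> sqrt (measure M \<Omega>) * (\<Sum>l=1..d. Lp_norm 1 M h * sup_norm \<Omega> (p l))"
    using cmod_inner_L2_basis_le[OF assms] by (intro mult_left_mono sum_mono) simp_all
  finally show ?thesis
    by (simp add: sum_distrib_left mult_ac)
qed

text \<open>Lebesgue's argument: the projection fixes every polynomial \<open>q\<close> of degree
  \<open>n\<close>, so the error for \<open>h\<close> equals the error for \<open>h - q\<close>,
  which is at most the projection norm plus 1 times the L1 norm of \<open>h - q\<close>.\<close>

lemma projection_error:
  assumes h: "integrable M h"
  shows "Lp_norm 1 M (\<lambda>y. (\<Sum>l=1..d. inner_L2 M h (p l) * p l y) - h y)
    \<le> (sqrt (measure M \<Omega>) * (\<Sum>l=1..d. sup_norm \<Omega> (p l)) + 1) * best_L1_error S \<Omega> M n h"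
    (is "?L \<le> ?C * _")
proof -
  have "0 \<le> (\<Sum>l=1..d. sup_norm \<Omega> (p l))"
    by (intro sum_nonneg sup_norm_nonneg continuous_on_basis)
  then have C: "0 < ?C"
    by (simp add: add_nonneg_pos)
  have *: "?L \<le> ?C * Lp_norm 1 M (\<lambda>y. h y - q y)" if q: "q \<in> polys S \<Omega> n" for q
  proof -
    define e where "e = (\<lambda>y. h y - q y)"
    have qc: "continuous_on \<Omega> q"
      using q by (rule continuous_on_polys)
    have e: "integrable M e"
      unfolding e_def using h integrable_continuous[OF qc] by simp
    have inner: "inner_L2 M h (p l) = inner_L2 M e (p l) + inner_L2 M q (p l)" if "l \<in> {1..d}" for l
    proof -
      have "integrable M (\<lambda>y. e y * cnj (p l y))" "integrable M (\<lambda>y. q y * cnj (p l y))"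
        using that e integrable_continuous[OF qc]
        by (auto intro!: integrable_mult_continuous continuous_on_cnj continuous_on_basis)
      then have "inner_L2 M e (p l) + inner_L2 M q (p l) = (\<integral>y. e y * cnj (p l y) + q y * cnj (p l y) \<partial>M)"
        unfolding inner_L2_def by (rule Bochner_Integration.integral_add[symmetric])
      then show ?thesis
        unfolding inner_L2_def by (simp add: e_def left_diff_distrib)
    qed
    have "?L = Lp_norm 1 M (\<lambda>y. (\<Sum>l=1..d. inner_L2 M e (p l) * p l y) - e y)"
    proof (rule Lp_norm_1_cong)
      fix y assume "y \<in> \<Omega>"
      have "(\<Sum>l=1..d. inner_L2 M h (p l) * p l y)
          = (\<Sum>l=1..d. inner_L2 M e (p l) * p l y) + (\<Sum>l=1..d. inner_L2 M q (p l) * p l y)"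
        by (simp add: inner distrib_right sum.distrib)
      then show "(\<Sum>l=1..d. inner_L2 M h (p l) * p l y) - h y
          = (\<Sum>l=1..d. inner_L2 M e (p l) * p l y) - e y"
        using polys_expansion[OF q \<open>y \<in> \<Omega>\<close>] by (simp add: e_def)
    qed
    also have "\<dots> \<le> Lp_norm 1 M (\<lambda>y. \<Sum>l=1..d. inner_L2 M e (p l) * p l y) + Lp_norm 1 M e"
      by (intro Lp_norm_1_diff integrable_continuous continuous_on_combination e)
    also have "\<dots> \<le> ?C * Lp_norm 1 M e"
      using Lp_norm_1_projection[OF e] by (simp add: distrib_right)
    finally show ?thesis
      unfolding e_def .
  qed
  \<comment> \<open>Division by the positive \<open>?C\<close> makes the left side a lower bound for
    all competing errors, so the infimum need not be attained.\<close>
  have "?L / ?C \<le> best_L1_error S \<Omega> M n h"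
    unfolding best_L1_error_def
  proof (rule cINF_greatest)
    show "polys S \<Omega> n \<noteq> {}"
      using polys_zero by blast
    show "?L / ?C \<le> Lp_norm 1 M (\<lambda>y. h y - q y)" if "q \<in> polys S \<Omega> n" for q
      using *[OF that] C by (simp add: pos_divide_le_eq mult.commute)
  qed
  then show ?thesis
    using C by (simp add: pos_divide_le_eq mult.commute)
qed

end

section \<open>Efficient hyperinterpolation\<close>

locale hyperinterpolation = orthonormal_polynomials M \<Omega> S n d p
  for M :: "(real^'s) measure" and \<Omega> S n d p +
  fixes m n' :: nat and w :: "nat \<Rightarrow> real" and x :: "nat \<Rightarrow> real^'s" and \<eta> :: real
  assumes quadrature: "quadrature_rule \<Omega> m w x"
    and exactness: "exactness_degree S \<Omega> M m w x (n + n')"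
    and MZ: "MZ_property S \<Omega> M m w x n n' \<eta>"
    and degree_le: "n' \<le> n"
begin

section \<open>Discrete norms and coefficients of the hyperinterpolant\<close>

lemma node_in: "j \<in> {1..m} \<Longrightarrow> x j \<in> \<Omega>"
  and weight_nonneg: "j \<in> {1..m} \<Longrightarrow> 0 \<le> w j"
  using quadrature unfolding quadrature_rule_def by (auto intro: less_imp_le)

text \<open>Absorbing \<open>sqrt (w j)\<close> into the vector turns the quadrature norm into a
  Euclidean one, to which the standard Cauchy--Schwarz inequality applies.\<close>

lemma L2_set_weights: "L2_set (\<lambda>j. sqrt (w j) * u j) {1..m} = sqrt (\<Sum>j=1..m. w j * (u j)\<^sup>2)"
  unfolding L2_set_def power_mult_distrib
  by (intro arg_cong[of _ _ sqrt] sum.cong refl) (simp only: real_sqrt_pow2 weight_nonneg)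

lemma eta_nonneg: "0 \<le> \<eta>" and eta_less_1: "\<eta> < 1"
  using MZ unfolding MZ_property_def by auto

lemma exact:
  "g \<in> polys S \<Omega> (n + n') \<Longrightarrow> (\<Sum>j=1..m. of_real (w j) * g (x j)) = (\<integral>y. g y \<partial>M)"
  using exactness unfolding exactness_degree_def by blast

text \<open>Exactness for the constant polynomial 1; this is how the total mass enters the discrete
  norm of \<open>f\<close>.\<close>

lemma sum_weights: "(\<Sum>j=1..m. w j) = measure M \<Omega>"
proof -
  have "complex_of_real (\<Sum>j=1..m. w j) = (\<integral>y. 1 \<partial>M)"
    using exact[OF polys_one] by simp
  also have "\<dots> = complex_of_real (measure M \<Omega>)"
    by (simp add: space_eq scaleR_conv_of_real)
  finally show ?thesis
    by (simp only: of_real_eq_iff)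
qed

text \<open>The Marcinkiewicz--Zygmund property speaks of real functions on the whole ambient space,
  whereas \<open>p l\<close> is known to be real only on \<Omega>. Taking \<open>Re (p l y)\<close>
  repairs this without changing values on \<Omega>; Parseval then evaluates the integral.\<close>

lemma MZ_real_combination:
  fixes b :: "nat \<Rightarrow> real"
  shows "(\<Sum>j=1..m. w j * (\<Sum>l=1..d. b l * Re (p l (x j)))\<^sup>2)
    \<le> (1 + \<eta>) * (\<Sum>l=1..d. (b l)\<^sup>2)"
proof -
  define q where "q = (\<lambda>y. \<Sum>l=1..d. b l * Re (p l y))"
  have q: "complex_of_real (q y) = (\<Sum>l=1..d. of_real (b l) * p l y)" if "y \<in> \<Omega>" for y
    unfolding q_def of_real_sum of_real_mult
    by (intro sum.cong refl) (simp add: of_real_Re basis_in_Reals that)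
  have "(\<lambda>y. \<Sum>l=1..d. of_real (b l) * p l y) \<in> polys S \<Omega> n"
    by (intro polys_sum polys_cmult basis_in_polys scalars_of_real)
  then have "(\<lambda>y. of_real (q y)) \<in> polys S \<Omega> n"
    by (rule polys_cong) (rule q)
  then have "\<bar>(\<Sum>j=1..m. w j * (q (x j))\<^sup>2) - (\<integral>y. (q y)\<^sup>2 \<partial>M)\<bar> \<le> \<eta> * (\<integral>y. (q y)\<^sup>2 \<partial>M)"
    using MZ unfolding MZ_property_def by blast
  then have "(\<Sum>j=1..m. w j * (q (x j))\<^sup>2) \<le> (1 + \<eta>) * (\<integral>y. (q y)\<^sup>2 \<partial>M)"
    by (simp add: distrib_right)
  also have "(\<integral>y. (q y)\<^sup>2 \<partial>M) = (\<integral>y. (cmod (\<Sum>l=1..d. of_real (b l) * p l y))\<^sup>2 \<partial>M)"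
    by (intro integral_eqI) (simp only: q[symmetric] norm_of_real power2_abs)
  also have "\<dots> = (\<Sum>l=1..d. (b l)\<^sup>2)"
    unfolding integral_norm_combination by (simp add: L2_set_def sum_nonneg)
  finally show ?thesis
    by (simp add: q_def)
qed

text \<open>The basis is real at the nodes, so the squared modulus splits into the combinations with
  coefficients \<open>Re (a l)\<close> and \<open>Im (a l)\<close>, each covered by the real
  case.\<close>

lemma quadrature_norm_combination:
  "(\<Sum>j=1..m. w j * (cmod (\<Sum>l=1..d. a l * p l (x j)))\<^sup>2)
    \<le> (1 + \<eta>) * (L2_set (\<lambda>l. cmod (a l)) {1..d})\<^sup>2"
proof -
  have eq: "(cmod (\<Sum>l=1..d. a l * p l (x j)))\<^sup>2
      = (\<Sum>l=1..d. Re (a l) * Re (p l (x j)))\<^sup>2 + (\<Sum>l=1..d. Im (a l) * Re (p l (x j)))\<^sup>2"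
    if "j \<in> {1..m}" for j
  proof -
    have "Im (p l (x j)) = 0" if "l \<in> {1..d}" for l
      using basis_in_Reals[OF that node_in[OF \<open>j \<in> {1..m}\<close>]] by (simp add: complex_is_Real_iff)
    then show ?thesis
      by (simp add: cmod_power2)
  qed
  have "(\<Sum>j=1..m. w j * (cmod (\<Sum>l=1..d. a l * p l (x j)))\<^sup>2)
      = (\<Sum>j=1..m. w j * (\<Sum>l=1..d. Re (a l) * Re (p l (x j)))\<^sup>2)
        + (\<Sum>j=1..m. w j * (\<Sum>l=1..d. Im (a l) * Re (p l (x j)))\<^sup>2)"
    unfolding sum.distrib[symmetric] distrib_left[symmetric] by (intro sum.cong refl) (simp only: eq)
  also have "\<dots> \<le> (1 + \<eta>) * (\<Sum>l=1..d. (Re (a l))\<^sup>2) + (1 + \<eta>) * (\<Sum>l=1..d. (Im (a l))\<^sup>2)"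
    by (intro add_mono MZ_real_combination)
  also have "\<dots> = (1 + \<eta>) * (\<Sum>l=1..d. (cmod (a l))\<^sup>2)"
    by (simp add: cmod_power2 sum.distrib distrib_left)
  finally show ?thesis
    by (simp add: L2_set_def sum_nonneg)
qed

lemma sqrt_one_plus_eta_le: "sqrt (1 + \<eta>) \<le> 1 / sqrt (1 - \<eta>)"
proof -
  have "sqrt (1 + \<eta>) * sqrt (1 - \<eta>) = sqrt (1 - \<eta>\<^sup>2)"
    by (simp add: power2_eq_square algebra_simps flip: real_sqrt_mult)
  also have "\<dots> \<le> 1"
    by simp
  finally show ?thesis
    using eta_less_1 by (simp add: pos_le_divide_eq)
qed

text \<open>For \<open>n' < n\<close> the exactness degree does not cover products of two basis
  elements, so the basis need not be orthonormal for the discrete inner product and Bessel's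
  inequality is not at hand. Duality with the hyperinterpolant \<open>g\<close> itself takes its
  place.\<close>

lemma coefficient_bound:
  assumes f: "continuous_on \<Omega> f"
  shows "L2_set (\<lambda>l. cmod (inner_quad m w x f (p l))) {1..d}
    \<le> sqrt (measure M \<Omega>) / sqrt (1 - \<eta>) * sup_norm \<Omega> f"
proof -
  define c where "c = (\<lambda>l. inner_quad m w x f (p l))"
  define g where "g = (\<lambda>y. \<Sum>l=1..d. c l * p l y)"
  define L where "L = L2_set (\<lambda>l. cmod (c l)) {1..d}"
  have L: "0 \<le> L"
    by (simp add: L_def L2_set_nonneg)
  have "complex_of_real (L\<^sup>2) = (\<Sum>l=1..d. c l * cnj (c l))"
    by (simp add: L_def L2_set_def sum_nonneg complex_norm_square flip: of_real_power)
  \<comment> \<open>Only the unconjugated \<open>c l\<close> is written out as a quadrature sum; the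
    conjugated one stays and becomes a coefficient of \<open>cnj (g (x j))\<close>.\<close>
  also have "\<dots> = (\<Sum>l=1..d. \<Sum>j=1..m. of_real (w j) * f (x j) * cnj (c l * p l (x j)))"
    by (intro sum.cong refl) (subst c_def, simp add: inner_quad_def sum_distrib_left mult_ac)
  also have "\<dots> = (\<Sum>j=1..m. \<Sum>l=1..d. of_real (w j) * f (x j) * cnj (c l * p l (x j)))"
    by (rule sum.swap)
  also have "\<dots> = (\<Sum>j=1..m. of_real (w j) * f (x j) * cnj (g (x j)))"
    by (simp only: g_def cnj_sum sum_distrib_left)
  finally have "L\<^sup>2 = cmod (\<Sum>j=1..m. of_real (w j) * f (x j) * cnj (g (x j)))"
    by (metis norm_of_real abs_power2)
  also have "\<dots> \<le> (\<Sum>j=1..m. cmod (of_real (w j) * f (x j) * cnj (g (x j))))"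
    by (rule norm_sum)
  \<comment> \<open>The weight is shared equally between the two factors; the absolute values give
    the form required by \<open>L2_set_mult_ineq\<close>.\<close>
  also have "\<dots> = (\<Sum>j=1..m. \<bar>sqrt (w j) * cmod (f (x j))\<bar> * \<bar>sqrt (w j) * cmod (g (x j))\<bar>)"
  proof (intro sum.cong refl)
    fix j assume "j \<in> {1..m}"
    then have w: "0 \<le> w j"
      by (rule weight_nonneg)
    have "(sqrt (w j) * cmod (f (x j))) * (sqrt (w j) * cmod (g (x j)))
        = (sqrt (w j) * sqrt (w j)) * cmod (f (x j)) * cmod (g (x j))"
      by (simp only: mult_ac)
    with w show "cmod (of_real (w j) * f (x j) * cnj (g (x j)))
        = \<bar>sqrt (w j) * cmod (f (x j))\<bar> * \<bar>sqrt (w j) * cmod (g (x j))\<bar>"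
      by (simp add: norm_mult abs_mult)
  qed
  also have "\<dots> \<le> L2_set (\<lambda>j. sqrt (w j) * cmod (f (x j))) {1..m}
      * L2_set (\<lambda>j. sqrt (w j) * cmod (g (x j))) {1..m}"
    by (rule L2_set_mult_ineq)
  also have "\<dots> \<le> (sqrt (measure M \<Omega>) * sup_norm \<Omega> f) * (sqrt (1 + \<eta>) * L)"
  proof (rule mult_mono)
    have "(\<Sum>j=1..m. w j * (cmod (f (x j)))\<^sup>2) \<le> (\<Sum>j=1..m. w j * (sup_norm \<Omega> f)\<^sup>2)"
      by (intro sum_mono mult_left_mono power_mono cmod_le_sup_norm[OF f] node_in weight_nonneg) simp_all
    also have "\<dots> = measure M \<Omega> * (sup_norm \<Omega> f)\<^sup>2"
      unfolding sum_distrib_right[symmetric] sum_weights ..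
    finally have "sqrt (\<Sum>j=1..m. w j * (cmod (f (x j)))\<^sup>2) \<le> sqrt (measure M \<Omega> * (sup_norm \<Omega> f)\<^sup>2)"
      by (rule real_sqrt_le_mono)
    then show "L2_set (\<lambda>j. sqrt (w j) * cmod (f (x j))) {1..m} \<le> sqrt (measure M \<Omega>) * sup_norm \<Omega> f"
      using sup_norm_nonneg[OF f] by (simp only: L2_set_weights real_sqrt_mult real_sqrt_abs abs_of_nonneg)
    have "sqrt (\<Sum>j=1..m. w j * (cmod (g (x j)))\<^sup>2) \<le> sqrt ((1 + \<eta>) * L\<^sup>2)"
      unfolding g_def L_def by (rule real_sqrt_le_mono[OF quadrature_norm_combination])
    then show "L2_set (\<lambda>j. sqrt (w j) * cmod (g (x j))) {1..m} \<le> sqrt (1 + \<eta>) * L"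
      using L by (simp only: L2_set_weights real_sqrt_mult real_sqrt_abs abs_of_nonneg)
  qed (simp_all add: L2_set_nonneg sup_norm_nonneg[OF f])
  finally have "L * L \<le> (sqrt (measure M \<Omega>) * sup_norm \<Omega> f * sqrt (1 + \<eta>)) * L"
    by (simp add: power2_eq_square mult_ac)
  \<comment> \<open>One factor \<open>L\<close> is about to be cancelled; nonnegativity of the bound
    settles the case \<open>L = 0\<close>.\<close>
  moreover have "0 \<le> sqrt (measure M \<Omega>) * sup_norm \<Omega> f * sqrt (1 + \<eta>)"
    using eta_nonneg by (simp add: sup_norm_nonneg[OF f])
  ultimately have "L \<le> sqrt (measure M \<Omega>) * sup_norm \<Omega> f * sqrt (1 + \<eta>)"
    using L by (cases "L = 0") (auto simp: mult_le_cancel_right)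
  also have "\<dots> \<le> sqrt (measure M \<Omega>) * sup_norm \<Omega> f * (1 / sqrt (1 - \<eta>))"
    by (intro mult_left_mono sqrt_one_plus_eta_le) (simp add: sup_norm_nonneg[OF f])
  finally show ?thesis
    by (simp add: L_def c_def)
qed

text \<open>The conjugate disappears because the basis is real on \<Omega>, and
  \<open>p l * q\<close> has degree at most \<open>n + n'\<close>. Thus discrete and continuous
  coefficients agree, and \<open>n' \<le> n\<close> makes the expansion of \<open>q\<close>
  available.\<close>

lemma hyperinterpolant_reproduces:
  assumes q: "q \<in> polys S \<Omega> n'" and "y \<in> \<Omega>"
  shows "hyperinterpolant m w x d p q y = q y"
proof -
  have "inner_quad m w x q (p l) = inner_L2 M q (p l)" if l: "l \<in> {1..d}" for l
  proof -
    have "(\<lambda>y. p l y * q y) \<in> polys S \<Omega> (n + n')"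
      using basis_in_polys[OF l] q by (rule polys_mult)
    then have "(\<lambda>y. q y * cnj (p l y)) \<in> polys S \<Omega> (n + n')"
      by (rule polys_cong) (simp add: cnj_basis[OF l])
    from exact[OF this] show ?thesis
      by (simp add: inner_quad_def inner_L2_def mult.assoc)
  qed
  then have "hyperinterpolant m w x d p q y = (\<Sum>l=1..d. inner_L2 M q (p l) * p l y)"
    by (simp add: hyperinterpolant_def)
  also have "\<dots> = q y"
    using polys_mono[OF q degree_le] assms(2) by (rule polys_expansion)
  finally show ?thesis .
qed

section \<open>Moment matrix, L2 bound and L1 error of the efficient hyperinterpolant\<close>

lemma efficient_hyperinterpolant_coefficient:
  assumes K: "integrable M K" and l: "l \<in> {1..d}"
  shows "(\<integral>t. K t * hyperinterpolant m w x d p f t * p l t \<partial>M)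
    = (\<Sum>l'=1..d. inner_quad m w x f (p l') * modified_moment M p K l' l)"
proof -
  have "integrable M (\<lambda>t. K t * p l' t * p l t)" if "l' \<in> {1..d}" for l'
    using that l by (intro integrable_mult_continuous K continuous_on_basis)
  moreover have "(\<integral>t. K t * hyperinterpolant m w x d p f t * p l t \<partial>M)
      = (\<integral>t. (\<Sum>l'=1..d. inner_quad m w x f (p l') * (K t * p l' t * p l t)) \<partial>M)"
    by (simp add: hyperinterpolant_def sum_distrib_left sum_distrib_right mult_ac)
  ultimately show ?thesis
    unfolding modified_moment_def by (simp add: Bochner_Integration.integral_sum)
qed

lemma Lp_norm_2_efficient_hyperinterpolant:
  assumes K: "integrable M K" and f: "continuous_on \<Omega> f"
  shows "Lp_norm 2 M (efficient_hyperinterpolant M m w x d p K f)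
    \<le> sqrt (measure M \<Omega>) * A_const M d p K / sqrt (1 - \<eta>) * sup_norm \<Omega> f"
proof -
  define c where "c = (\<lambda>l. inner_quad m w x f (p l))"
  define \<alpha> where "\<alpha> = modified_moment M p K"
  define L where "L = L2_set (\<lambda>l. cmod (c l)) {1..d}"
  have "Lp_norm 2 M (efficient_hyperinterpolant M m w x d p K f)
      = L2_set (\<lambda>l. cmod (\<integral>t. K t * hyperinterpolant m w x d p f t * p l t \<partial>M)) {1..d}"
    unfolding efficient_hyperinterpolant_def by (rule Lp_norm_2_combination)
  also have "\<dots> = L2_set (\<lambda>l. cmod (\<Sum>l'=1..d. c l' * \<alpha> l' l)) {1..d}"
    by (intro L2_set_cong refl) (simp add: efficient_hyperinterpolant_coefficient[OF K] c_def \<alpha>_def)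
  \<comment> \<open>Cauchy--Schwarz for each fixed \<open>l\<close>. After \<open>L\<close> is
    pulled out, the nested norms form the Frobenius norm of the moment matrix.\<close>
  also have "\<dots> \<le> L2_set (\<lambda>l. L * L2_set (\<lambda>l'. cmod (\<alpha> l' l)) {1..d}) {1..d}"
  proof (rule L2_set_mono)
    fix l
    have "cmod (\<Sum>l'=1..d. c l' * \<alpha> l' l) \<le> (\<Sum>l'=1..d. \<bar>cmod (c l')\<bar> * \<bar>cmod (\<alpha> l' l)\<bar>)"
      using norm_sum[of "\<lambda>l'. c l' * \<alpha> l' l" "{1..d}"] by (simp add: norm_mult)
    also have "\<dots> \<le> L * L2_set (\<lambda>l'. cmod (\<alpha> l' l)) {1..d}"
      unfolding L_def by (rule L2_set_mult_ineq)
    finally show "cmod (\<Sum>l'=1..d. c l' * \<alpha> l' l) \<le> L * L2_set (\<lambda>l'. cmod (\<alpha> l' l)) {1..d}" .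
  qed simp
  also have "\<dots> = L * A_const M d p K"
    by (simp add: L2_set_right_distrib[symmetric] L_def L2_set_nonneg)
      (simp add: A_const_def L2_set_def \<alpha>_def sum_nonneg)
  also have "\<dots> \<le> (sqrt (measure M \<Omega>) / sqrt (1 - \<eta>) * sup_norm \<Omega> f) * A_const M d p K"
    unfolding L_def c_def
    by (intro mult_right_mono coefficient_bound f) (simp add: A_const_def sum_nonneg)
  finally show ?thesis
    by (simp add: mult_ac)
qed

text \<open>The moment form of the coefficients is linear in the quadrature coefficients of the
  second factor, so no integral has to be split.\<close>

lemma efficient_hyperinterpolant_diff:
  assumes "integrable M K"
  shows "efficient_hyperinterpolant M m w x d p K (\<lambda>y. f y - g y) y
    = efficient_hyperinterpolant M m w x d p K f y - efficient_hyperinterpolant M m w x d p K g y"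
proof -
  have "inner_quad m w x (\<lambda>y. f y - g y) z = inner_quad m w x f z - inner_quad m w x g z" for z
    by (simp add: inner_quad_def algebra_simps sum_subtractf)
  then show ?thesis
    unfolding efficient_hyperinterpolant_def
    by (simp add: efficient_hyperinterpolant_coefficient[OF assms] left_diff_distrib sum_subtractf)
qed

lemma efficient_hyperinterpolant_polys:
  assumes "q \<in> polys S \<Omega> n'"
  shows "efficient_hyperinterpolant M m w x d p K q y
    = (\<Sum>l=1..d. inner_L2 M (\<lambda>t. K t * q t) (p l) * p l y)"
proof -
  have "(\<integral>t. K t * hyperinterpolant m w x d p q t * p l t \<partial>M) = inner_L2 M (\<lambda>t. K t * q t) (p l)"
    if "l \<in> {1..d}" for l
    unfolding inner_L2_def
    by (intro integral_eqI) (simp add: hyperinterpolant_reproduces[OF assms] cnj_basis[OF that])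
  then show ?thesis
    by (simp add: efficient_hyperinterpolant_def)
qed

text \<open>The estimate holds for each competitor \<open>q\<close>; inserting a best uniform
  approximation afterwards turns the sup norm into the best error.\<close>

lemma efficient_hyperinterpolant_error:
  assumes K: "integrable M K" and f: "continuous_on \<Omega> f" and q: "q \<in> polys S \<Omega> n'"
  shows "Lp_norm 1 M (\<lambda>y. efficient_hyperinterpolant M m w x d p K f y - K y * f y)
    \<le> (measure M \<Omega> * A_const M d p K / sqrt (1 - \<eta>) + Lp_norm 1 M K) * sup_norm \<Omega> (\<lambda>y. f y - q y)
      + (sqrt (measure M \<Omega>) * (\<Sum>l=1..d. sup_norm \<Omega> (p l)) + 1)
        * best_L1_error S \<Omega> M n (\<lambda>y. K y * q y)"
proof -
  define e where "e = (\<lambda>y. f y - q y)"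
  define S1 where "S1 = efficient_hyperinterpolant M m w x d p K e"
  define P where "P = (\<lambda>y. \<Sum>l=1..d. inner_L2 M (\<lambda>t. K t * q t) (p l) * p l y)"
  have qc: "continuous_on \<Omega> q"
    using q by (rule continuous_on_polys)
  have ec: "continuous_on \<Omega> e"
    unfolding e_def using f qc by (rule continuous_on_diff)
  have S1c: "continuous_on \<Omega> S1"
    unfolding S1_def efficient_hyperinterpolant_def by (rule continuous_on_combination)
  have Pc: "continuous_on \<Omega> P"
    unfolding P_def by (rule continuous_on_combination)
  have Kq: "integrable M (\<lambda>y. K y * q y)" and Ke: "integrable M (\<lambda>y. K y * e y)"
    by (intro integrable_mult_continuous K qc ec)+
  have Pd: "integrable M (\<lambda>y. P y - K y * q y)"
    using integrable_continuous[OF Pc] Kq by (rule Bochner_Integration.integrable_diff)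
  \<comment> \<open>With \<open>f = e + q\<close>, the error splits into the efficient
    hyperinterpolant of \<open>K e\<close>, the projection error of \<open>K q\<close>, and
    \<open>- K e\<close>; these give the three terms of the bound.\<close>
  have sum: "efficient_hyperinterpolant M m w x d p K f y - K y * f y
      = (S1 y + (P y - K y * q y)) - K y * e y" for y
    using efficient_hyperinterpolant_diff[OF K, of f q y] efficient_hyperinterpolant_polys[OF q, of K y]
    by (simp add: S1_def P_def e_def algebra_simps)
  \<comment> \<open>The full factor \<open>V\<close> is a product of two roots: one from passing
    from L1 to L2, the other from the L2 bound.\<close>
  have "Lp_norm 1 M S1 \<le> sqrt (measure M \<Omega>) * Lp_norm 2 M S1"
    using S1c by (rule Lp_norm_1_le_Lp_norm_2)
  also have "\<dots> \<le> sqrt (measure M \<Omega>)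
      * (sqrt (measure M \<Omega>) * A_const M d p K / sqrt (1 - \<eta>) * sup_norm \<Omega> e)"
    unfolding S1_def by (intro mult_left_mono Lp_norm_2_efficient_hyperinterpolant K ec) simp
  also have "\<dots> = (sqrt (measure M \<Omega>) * sqrt (measure M \<Omega>)) * A_const M d p K / sqrt (1 - \<eta>) * sup_norm \<Omega> e"
    by (simp only: mult.assoc times_divide_eq_right times_divide_eq_left)
  finally have S1: "Lp_norm 1 M S1 \<le> measure M \<Omega> * A_const M d p K / sqrt (1 - \<eta>) * sup_norm \<Omega> e"
    by simp
  have "Lp_norm 1 M (\<lambda>y. efficient_hyperinterpolant M m w x d p K f y - K y * f y)
      \<le> Lp_norm 1 M (\<lambda>y. S1 y + (P y - K y * q y)) + Lp_norm 1 M (\<lambda>y. K y * e y)"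
    unfolding sum
    by (intro Lp_norm_1_diff Bochner_Integration.integrable_add integrable_continuous[OF S1c] Pd Ke)
  also have "\<dots> \<le> (Lp_norm 1 M S1 + Lp_norm 1 M (\<lambda>y. P y - K y * q y)) + Lp_norm 1 M K * sup_norm \<Omega> e"
    by (intro add_mono Lp_norm_1_add Lp_norm_1_mult_sup_norm integrable_continuous[OF S1c] Pd K ec)
  also have "\<dots> \<le> (measure M \<Omega> * A_const M d p K / sqrt (1 - \<eta>) * sup_norm \<Omega> e
      + (sqrt (measure M \<Omega>) * (\<Sum>l=1..d. sup_norm \<Omega> (p l)) + 1)
        * best_L1_error S \<Omega> M n (\<lambda>y. K y * q y)) + Lp_norm 1 M K * sup_norm \<Omega> e"
    unfolding P_def by (intro add_mono S1 projection_error[OF Kq] order_refl)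
  finally show ?thesis
    by (simp add: e_def distrib_right)
qed

end

theorem theorem4p1:
  fixes \<Omega> :: "(real^'s) set" and M :: "(real^'s) measure"
    and K f F :: "real^'s \<Rightarrow> complex" and S :: "complex set"
    and n n' d m :: nat and p :: "nat \<Rightarrow> real^'s \<Rightarrow> complex"
    and w :: "nat \<Rightarrow> real" and x :: "nat \<Rightarrow> real^'s" and \<eta> V :: real
  assumes "region \<Omega>" and "finite_measure_on \<Omega> M" and "V = measure M \<Omega>"
    and "integrable M K" and "continuous_on \<Omega> f" and "F = (\<lambda>y. K y * f y)"
    and "S = scalars \<Omega> K f"
    and "0 < n'" and "n' \<le> n"
    and "real_orthonormal_basis S \<Omega> M n d p"
    and "quadrature_rule \<Omega> m w x"
    and "exactness_degree S \<Omega> M m w x (n + n')"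
    and "MZ_property S \<Omega> M m w x n n' \<eta>"
  shows "Lp_norm 2 M (efficient_hyperinterpolant M m w x d p K f)
           \<le> sqrt V * A_const M d p K / sqrt (1 - \<eta>) * sup_norm \<Omega> f
    \<and> (\<forall>q. best_unif_approx S \<Omega> n' f q \<longrightarrow>
          Lp_norm 1 M (\<lambda>y. efficient_hyperinterpolant M m w x d p K f y - F y)
            \<le> (V * A_const M d p K / sqrt (1 - \<eta>) + Lp_norm 1 M K) * best_unif_error S \<Omega> n' f
              + (sqrt V * (\<Sum>l=1..d. sup_norm \<Omega> (p l)) + 1)
                * best_L1_error S \<Omega> M n (\<lambda>y. K y * q y))"
proof -
  have region: "compact \<Omega>" "\<Omega> \<noteq> {}"
    using assms(1) by (rule compact_region, rule region_nonempty)
  have M: "finite_measure M" "space M = \<Omega>" "sets (restrict_space borel \<Omega>) \<subseteq> sets M"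
    using assms(2) by (simp_all add: finite_measure_on_def)
  have S: "S = \<real> \<or> S = UNIV"
    using assms(7) by (simp add: scalars_def)
  interpret finite_measure M
    by (rule M(1))
  interpret hyperinterpolation M \<Omega> S n d p m n' w x \<eta>
    by unfold_locales (fact region M S assms)+
  show ?thesis
  proof (intro conjI allI impI)
    show "Lp_norm 2 M (efficient_hyperinterpolant M m w x d p K f)
        \<le> sqrt V * A_const M d p K / sqrt (1 - \<eta>) * sup_norm \<Omega> f"
      unfolding assms(3) using assms(4,5) by (rule Lp_norm_2_efficient_hyperinterpolant)
  next
    fix q
    assume "best_unif_approx S \<Omega> n' f q"
    then have q: "q \<in> polys S \<Omega> n'"
      and "best_unif_error S \<Omega> n' f = sup_norm \<Omega> (\<lambda>y. f y - q y)"
      by (simp_all add: best_unif_approx_def)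
    then show "Lp_norm 1 M (\<lambda>y. efficient_hyperinterpolant M m w x d p K f y - F y)
        \<le> (V * A_const M d p K / sqrt (1 - \<eta>) + Lp_norm 1 M K) * best_unif_error S \<Omega> n' f
          + (sqrt V * (\<Sum>l=1..d. sup_norm \<Omega> (p l)) + 1)
            * best_L1_error S \<Omega> M n (\<lambda>y. K y * q y)"
      using efficient_hyperinterpolant_error[OF assms(4,5) q] by (simp only: assms(3,6))
  qed
qed

end
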